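(* For all integers $n\ge 1$ and $0\le k\le n^2$, $$i_{B_q}(n,k)=\sum_{P\in\mathcal{P}^{B}_{n,k}}q^{\omega t(P)}.$$
   Context: $B_n$ is the hyperoctahedral group: the group of bijections $\pi$ of $\{-n,\ldots,-1,1,\ldots,n\}$ with $\pi(-j)=-\pi(j)$ for all $j\in\{1,\dots,n\}$. Every $\pi\in B_n$ is written uniquely as $\pi(p)=(-1)^{r_p}\sigma_p$ for $1\le p\le n$, with $r_p\in\{0,1\}$ and $\sigma=\sigma_1\cdots\sigma_n$ a permutation of $\{1,\dots,n\}$. For $1\le i\le n$ put $m=n+1-i$ and $inv_i(\sigma)=|\{j: j<m,\ \sigma_j>\sigma_m\}|$, and define $inv_i(\pi)=inv_i(\sigma)$ if $r_m=0$, and $inv_i(\pi)=1+2|\{j: j<m,\ \sigma_j<\sigma_m\}|+inv_i(\sigma)$ if $r_m=1$. Put $inv_B(\pi)=\sum_{i=1}^n inv_i(\pi)$, $I_B(n,k)=\{\pi\in B_n: inv_B(\pi)=k\}$ and $\omega(\pi)=\sum_{i=1}^n(n-i+1)\,inv_i(\pi)$. With $q$ an indeterminate, the $q$-Mahonian number of type $B$ is $i_{B_q}(n,k)=\sum_{\pi\in I_B(n,k)}q^{\omega(\pi)}$. $\mathcal{P}^{B}_{n,k}$ is the set of lattice paths from $(0,0)$ to $(n,k)$ using only North steps $(0,1)$ and East steps $(1,0)$, such that for each $j\in\{1,\dots,n\}$ the number of North steps at level $j$ (on the vertical line $x=j$) is at most $2j-1$, and there are no North steps on the line $x=0$. The weight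 $\omega t(P)$ is the number of unit boxes above (and to the left of) $P$ in the $n\times k$ rectangle, i.e. $\omega t(P)=\sum_{j=1}^n j\cdot(\text{number of North steps of }P\text{ at level }j)$. *)

theory Defs
  imports "HOL-Combinatorics.Permutations" "HOL-Computational_Algebra.Polynomial"
begin

(* Elements of B_n are total functions on int that fix every integer outside
   {-n..-1} \<union> {1..n}; "permutes" makes this representation unique. *)
definition hyperoctahedral :: "nat \<Rightarrow> (int \<Rightarrow> int) set" where
  "hyperoctahedral n =
     {\<pi>. \<pi> permutes ({- int n..int n} - {0}) \<and> (\<forall>j\<in>{1..int n}. \<pi> (- j) = - \<pi> j)}"

definition sgn_exp :: "(int \<Rightarrow> int) \<Rightarrow> nat \<Rightarrow> nat" where
  "sgn_exp \<pi> p = (if \<pi> (int p) < 0 then 1 else 0)"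

definition und_perm :: "(int \<Rightarrow> int) \<Rightarrow> nat \<Rightarrow> nat" where
  "und_perm \<pi> p = nat \<bar>\<pi> (int p)\<bar>"

(* sgn_exp and und_perm are the unique r and \<sigma> with \<pi>(p) = (-1)^(r p) * \<sigma>(p), 1 \<le> p \<le> n. *)
lemma signed_form: "\<pi> (int p) = (-1) ^ sgn_exp \<pi> p * int (und_perm \<pi> p)"
  by (simp add: sgn_exp_def und_perm_def)

lemma signed_form_unique:
  assumes "\<pi> (int p) = (-1) ^ r * int s" "r \<in> {0, 1}" "s \<ge> 1"
  shows "r = sgn_exp \<pi> p \<and> s = und_perm \<pi> p"
  using assms by (auto simp: sgn_exp_def und_perm_def)

lemma und_perm_bij:
  assumes "\<pi> \<in> hyperoctahedral n"
  shows "bij_betw (und_perm \<pi>) {1..n} {1..n}"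
proof -
  let ?S = "{- int n..int n} - {0}"
  have perm: "\<pi> permutes ?S" and odd: "\<And>j. j \<in> {1..int n} \<Longrightarrow> \<pi> (- j) = - \<pi> j"
    using assms by (auto simp: hyperoctahedral_def)
  have into: "und_perm \<pi> ` {1..n} \<subseteq> {1..n}"
  proof (rule image_subsetI)
    fix p assume "p \<in> {1..n}"
    hence "int p \<in> ?S" by auto
    hence "\<pi> (int p) \<in> ?S" using permutes_in_image[OF perm] by blast
    thus "und_perm \<pi> p \<in> {1..n}" by (auto simp: und_perm_def)
  qed
  have inj: "inj_on (und_perm \<pi>) {1..n}"
  proof (rule inj_onI)
    fix p p' assume p: "p \<in> {1..n}" "p' \<in> {1..n}" "und_perm \<pi> p = und_perm \<pi> p'"
    hence "\<bar>\<pi> (int p)\<bar> = \<bar>\<pi> (int p')\<bar>" by (simp add: und_perm_def)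
    hence "\<pi> (int p) = \<pi> (int p') \<or> \<pi> (int p) = - \<pi> (int p')"
      by (simp only: abs_eq_iff)
    moreover have "\<pi> (- int p') = - \<pi> (int p')" using p by (intro odd) simp
    ultimately have "\<pi> (int p) = \<pi> (int p') \<or> \<pi> (int p) = \<pi> (- int p')" by argo
    hence "int p = int p' \<or> int p = - int p'"
      by (simp only: inj_eq[OF permutes_inj[OF perm]])
    thus "p = p'" using p by auto
  qed
  show ?thesis
    using inj into by (simp add: bij_betw_def card_image card_subset_eq)
qed

definition inv_sigma :: "nat \<Rightarrow> (nat \<Rightarrow> nat) \<Rightarrow> nat \<Rightarrow> nat" where
  "inv_sigma n \<sigma> i = (let m = n + 1 - i in card {j \<in> {1..<m}. \<sigma> j > \<sigma> m})"

definition inv_pi :: "nat \<Rightarrow> (int \<Rightarrow> int) \<Rightarrow> nat \<Rightarrow> nat" where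
  "inv_pi n \<pi> i =
     (let m = n + 1 - i; \<sigma> = und_perm \<pi> in
      if sgn_exp \<pi> m = 0 then inv_sigma n \<sigma> i
      else 1 + 2 * card {j \<in> {1..<m}. \<sigma> j < \<sigma> m} + inv_sigma n \<sigma> i)"

definition inv_B :: "nat \<Rightarrow> (int \<Rightarrow> int) \<Rightarrow> nat" where
  "inv_B n \<pi> = (\<Sum>i=1..n. inv_pi n \<pi> i)"

definition I_B :: "nat \<Rightarrow> nat \<Rightarrow> (int \<Rightarrow> int) set" where
  "I_B n k = {\<pi> \<in> hyperoctahedral n. inv_B n \<pi> = k}"

definition omega :: "nat \<Rightarrow> (int \<Rightarrow> int) \<Rightarrow> nat" where
  "omega n \<pi> = (\<Sum>i=1..n. (n - i + 1) * inv_pi n \<pi> i)"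

abbreviation q_var :: "int poly" where
  "q_var \<equiv> [:0, 1:]"

definition q_mahonian_B :: "nat \<Rightarrow> nat \<Rightarrow> int poly" where
  "q_mahonian_B n k = (\<Sum>\<pi>\<in>I_B n k. q_var ^ omega n \<pi>)"

lemma finite_I_B: "finite (I_B n k)"
proof (rule finite_subset)
  show "I_B n k \<subseteq> {\<pi>. \<pi> permutes ({- int n..int n} - {0})}"
    by (auto simp: I_B_def hyperoctahedral_def)
qed (simp add: finite_permutations)

datatype step = North | East

(* A path starting at (0,0) is its list of steps; the step w ! t starts at the point
   (x_coord w t, y_coord w t). *)
definition x_coord :: "step list \<Rightarrow> nat \<Rightarrow> nat" where
  "x_coord w t = count_list (take t w) East"

definition y_coord :: "step list \<Rightarrow> nat \<Rightarrow> nat" where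
  "y_coord w t = count_list (take t w) North"

definition norths_at :: "step list \<Rightarrow> nat \<Rightarrow> nat" where
  "norths_at w j = card {t. t < length w \<and> w ! t = North \<and> x_coord w t = j}"

definition lattice_paths :: "nat \<Rightarrow> nat \<Rightarrow> step list set" where
  "lattice_paths n k = {w. x_coord w (length w) = n \<and> y_coord w (length w) = k}"

definition paths_B :: "nat \<Rightarrow> nat \<Rightarrow> step list set" where
  "paths_B n k = {w \<in> lattice_paths n k.
     norths_at w 0 = 0 \<and> (\<forall>j\<in>{1..n}. norths_at w j \<le> 2 * j - 1)}"

(* The pair (a, b) stands for the box [a, a+1] x [b, b+1].  It is above and to the left of
   the path iff the North step that crosses the row y \<in> [b, b+1] is on a line x = c, c > a. *)
definition boxes_above :: "nat \<Rightarrow> nat \<Rightarrow> step list \<Rightarrow> (nat \<times> nat) set" where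
  "boxes_above n k w = {(a, b). a < n \<and> b < k \<and>
     (\<exists>t < length w. w ! t = North \<and> y_coord w t = b \<and> a < x_coord w t)}"

definition path_weight :: "nat \<Rightarrow> nat \<Rightarrow> step list \<Rightarrow> nat" where
  "path_weight n k w = card (boxes_above n k w)"

lemma finite_paths_B: "finite (paths_B n k)"
proof (rule finite_subset)
  have len: "length w = count_list w East + count_list w North" for w
  proof (induction w)
    case (Cons s w) thus ?case by (cases s) auto
  qed simp
  have U: "(UNIV :: step set) = {North, East}" using step.exhaust by auto
  show "paths_B n k \<subseteq> {w. set w \<subseteq> UNIV \<and> length w = n + k}"
    by (auto simp: paths_B_def lattice_paths_def x_coord_def y_coord_def len)
  show "finite {w. set w \<subseteq> (UNIV :: step set) \<and> length w = n + k}"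
    by (rule finite_lists_length_eq) (simp add: U)
qed

lemma count_list_take_mono:
  "s \<le> t \<Longrightarrow> count_list (take s w) x \<le> count_list (take t w) x"
  by (metis count_list_append le_add1 le_add_diff_inverse take_add)

lemma y_coord_less:
  assumes "s < t" "t \<le> length w" "w ! s = North"
  shows "y_coord w s < y_coord w t"
proof -
  have "y_coord w s < y_coord w (Suc s)"
    using assms by (simp add: y_coord_def take_Suc_conv_app_nth)
  also have "\<dots> \<le> y_coord w t"
    using assms count_list_take_mono[of "Suc s" t w North] by (simp add: y_coord_def)
  finally show ?thesis .
qed

lemma path_weight_eq_sum:
  assumes "w \<in> lattice_paths n k"
  shows "path_weight n k w = (\<Sum>j=1..n. j * norths_at w j)"
proof -
  define T where "T = {t. t < length w \<and> w ! t = North}"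
  have fin: "finite T" by (simp add: T_def)
  have xn: "x_coord w t \<le> n" if "t \<in> T" for t
    using that assms count_list_take_mono[of t "length w" w East]
    by (simp add: T_def lattice_paths_def x_coord_def)
  have yk: "y_coord w t < k" if "t \<in> T" for t
    using that assms y_coord_less[of t "length w" w] by (simp add: T_def lattice_paths_def)
  have inj: "inj_on (y_coord w) T"
  proof (rule inj_onI, rule ccontr)
    fix s t assume "s \<in> T" "t \<in> T" "y_coord w s = y_coord w t" "s \<noteq> t"
    thus False using y_coord_less[of s t w] y_coord_less[of t s w]
      by (cases "s < t") (auto simp: T_def)
  qed
  have "boxes_above n k w = (\<lambda>(t, a). (a, y_coord w t)) ` (SIGMA t:T. {..<x_coord w t})"
  proof (intro subset_antisym subsetI)
    fix c assume "c \<in> boxes_above n k w"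
    then obtain a t where "c = (a, y_coord w t)" "t \<in> T" "a < x_coord w t"
      by (auto simp: boxes_above_def T_def)
    thus "c \<in> (\<lambda>(t, a). (a, y_coord w t)) ` (SIGMA t:T. {..<x_coord w t})"
      by (intro image_eqI[of _ _ "(t, a)"]) auto
  next
    fix c assume "c \<in> (\<lambda>(t, a). (a, y_coord w t)) ` (SIGMA t:T. {..<x_coord w t})"
    then obtain a t where c: "c = (a, y_coord w t)" "t \<in> T" "a < x_coord w t" by auto
    thus "c \<in> boxes_above n k w"
      using xn[of t] yk[of t] by (auto simp: boxes_above_def T_def)
  qed
  moreover have "inj_on (\<lambda>(t, a). (a, y_coord w t)) (SIGMA t:T. {..<x_coord w t})"
    using inj by (auto simp: inj_on_def)
  ultimately have "path_weight n k w = (\<Sum>t\<in>T. x_coord w t)"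
    using fin by (simp add: path_weight_def card_image)
  also have "\<dots> = (\<Sum>j\<in>{0..n}. \<Sum>t\<in>{t \<in> T. x_coord w t = j}. x_coord w t)"
    using fin xn by (intro sum.group[symmetric]) auto
  also have "\<dots> = (\<Sum>j\<in>{0..n}. j * norths_at w j)"
    by (intro sum.cong) (auto simp: norths_at_def T_def conj_assoc mult.commute)
  also have "\<dots> = (\<Sum>j=1..n. j * norths_at w j)"
    by (simp add: sum.atLeast_Suc_atMost)
  finally show ?thesis .
qed

end

theory Submission
  imports Defs
begin

text \<open>
  Both sides are generating functions of one and the same set of integer vectors. Call
  \<open>c\<close> a code if \<open>0 \<le> c m \<le> 2 m - 1\<close> for \<open>m = 1, \<dots>, n\<close>; its total is \<open>\<Sum>m. c m\<close> and its
  weight is \<open>\<Sum>m. m * c m\<close>.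

  A path is determined by the numbers of its North steps on the lines \<open>x = 1, \<dots>, n\<close>, and
  these numbers may be chosen freely below the bounds, so they form an arbitrary code. Its
  total is the height \<open>k\<close> of the path and its weight is the number of boxes above the
  path (lemma \<open>bij_betw_north_code\<close>).

  A signed permutation has the code whose entry at the position \<open>m\<close> is
  \<open>inv\<^sub>i\<close> for \<open>i = n + 1 - m\<close>; then the total is \<open>inv\<^sub>B\<close> and the weight is \<open>\<omega>\<close>. Let \<open>a\<close> be the
  number of earlier positions \<open>j < m\<close> with \<open>\<sigma> j < \<sigma> m\<close>. The other \<open>m - 1 - a\<close> earlier
  positions carry larger values, so the entry is \<open>m - 1 - a < m\<close> if the sign at
  \<open>m\<close> is positive, and \<open>1 + 2 a + (m - 1 - a) = m + a \<ge> m\<close> if it is negative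
  (lemma \<open>inv_code_eq\<close>). Hence the entry determines both the sign and \<open>a\<close>. The numbers \<open>a\<close>
  for all \<open>m\<close> form a Lehmer code of \<open>\<sigma>\<close> and determine \<open>\<sigma>\<close>
  (lemma \<open>bij_betw_eq_if_smaller_before_eq\<close>), so the coding is injective; it is surjective
  because there are \<open>2 * 4 * \<dots> * 2 n = 2 ^ n * n!\<close> codes and at least as many
  signed permutations (lemma \<open>bij_betw_inv_code\<close>).
\<close>

section \<open>Codes with bounded entries\<close>

definition codes :: "nat \<Rightarrow> (nat \<Rightarrow> nat) set" where
  "codes n = (\<Pi>\<^sub>E m\<in>{1..n}. {..<2 * m})"

lemma card_codes: "card (codes n) = 2 ^ n * fact n"
proof -
  have "(\<Prod>m=1..n. 2 * m) = 2 ^ n * fact n"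
    by (simp add: prod.distrib fact_prod)
  thus ?thesis by (simp add: codes_def card_PiE)
qed

lemma finite_codes: "finite (codes n)"
  unfolding codes_def by (intro finite_PiE) auto

section \<open>Permutations and their smaller-predecessor counts\<close>

definition smaller_before :: "(nat \<Rightarrow> 'a::linorder) \<Rightarrow> nat \<Rightarrow> nat" where
  "smaller_before \<sigma> m = card {j \<in> {1..<m}. \<sigma> j < \<sigma> m}"

text \<open>The number of smaller elements is strictly increasing along a finite chain.\<close>

lemma rank_eq_imp_eq:
  fixes x y :: "'a::linorder"
  assumes "finite A" "x \<in> A" "y \<in> A"
    and "card {z \<in> A. z < x} = card {z \<in> A. z < y}"
  shows "x = y"
proof -
  have "card {z \<in> A. z < u} < card {z \<in> A. z < v}" if "u < v" "u \<in> A" for u v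
    using that assms(1) by (intro psubset_card_mono) auto
  from this[of x y] this[of y x] assms show ?thesis
    by (cases x y rule: linorder_cases) auto
qed

lemma smaller_before_eq_rank:
  assumes "inj_on \<sigma> {1..m}"
  shows "smaller_before \<sigma> m = card {z \<in> \<sigma> ` {1..m}. z < \<sigma> m}"
proof -
  have "{z \<in> \<sigma> ` {1..m}. z < \<sigma> m} = \<sigma> ` {j \<in> {1..<m}. \<sigma> j < \<sigma> m}"
    by (force simp: le_less)
  moreover have "inj_on \<sigma> {j \<in> {1..<m}. \<sigma> j < \<sigma> m}"
    using assms by (rule inj_on_subset) auto
  ultimately show ?thesis
    by (simp add: smaller_before_def card_image)
qed

text \<open>
  The values are recovered from the last position to the first. Once the values at
  the positions after \<open>m\<close> are known, so is the set of the values at \<open>1, \<dots>, m\<close>, and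
  \<open>smaller_before\<close> tells the rank of the value at \<open>m\<close> in that set.
\<close>

lemma bij_betw_eq_if_smaller_before_eq:
  assumes \<sigma>: "bij_betw \<sigma> {1..n} A" and \<tau>: "bij_betw \<tau> {1..n} A"
    and eq: "\<And>m. m \<in> {1..n} \<Longrightarrow> smaller_before \<sigma> m = smaller_before \<tau> m"
    and "m \<in> {1..n}"
  shows "\<sigma> m = \<tau> m"
  using \<open>m \<in> {1..n}\<close>
proof (induction "n - m" arbitrary: m rule: less_induct)
  case less
  have image: "\<rho> ` {1..m} = A - \<rho> ` {m<..n}" if "bij_betw \<rho> {1..n} A" for \<rho>
  proof -
    have "\<rho> ` ({1..n} - {m<..n}) = \<rho> ` {1..n} - \<rho> ` {m<..n}"
      using that by (intro inj_on_image_set_diff[of _ "{1..n}"]) (auto simp: bij_betw_def)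
    moreover have "{1..n} - {m<..n} = {1..m}" using less.prems by auto
    ultimately show ?thesis using that by (simp add: bij_betw_def)
  qed
  have "\<sigma> ` {m<..n} = \<tau> ` {m<..n}"
    using less.hyps by (intro image_cong) auto
  hence same: "\<sigma> ` {1..m} = \<tau> ` {1..m}"
    using image[OF \<sigma>] image[OF \<tau>] by simp
  have "inj_on \<sigma> {1..m}" "inj_on \<tau> {1..m}"
    using \<sigma> \<tau> less.prems by (auto simp: bij_betw_def intro: inj_on_subset)
  hence "card {z \<in> \<sigma> ` {1..m}. z < \<sigma> m} = card {z \<in> \<sigma> ` {1..m}. z < \<tau> m}"
    using smaller_before_eq_rank[of \<sigma> m] smaller_before_eq_rank[of \<tau> m] eq[OF less.prems]
    by (simp only: same)
  moreover have "\<sigma> m \<in> \<sigma> ` {1..m}"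
    using less.prems by auto
  moreover have "\<tau> m \<in> \<sigma> ` {1..m}"
    unfolding same using less.prems by auto
  ultimately show ?case by (intro rank_eq_imp_eq[of "\<sigma> ` {1..m}"]) auto
qed

section \<open>Inversion codes of signed permutations\<close>

text \<open>
  The statistic \<open>inv\<^sub>i\<close> counts positions from the right; the code is indexed by the position
  itself, so that the entry at \<open>m\<close> has the weight factor \<open>m\<close> and matches the North
  steps on the line \<open>x = m\<close>. It is extended by \<open>undefined\<close> as the functions in \<open>codes\<close> are.
\<close>

definition inv_code :: "nat \<Rightarrow> (int \<Rightarrow> int) \<Rightarrow> nat \<Rightarrow> nat" where
  "inv_code n \<pi> = (\<lambda>m\<in>{1..n}. inv_pi n \<pi> (n + 1 - m))"

lemma smaller_before_less: "m \<ge> 1 \<Longrightarrow> smaller_before \<sigma> m < m"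
proof -
  assume "m \<ge> 1"
  have "smaller_before \<sigma> m \<le> card {1..<m}"
    unfolding smaller_before_def by (intro card_mono) auto
  thus ?thesis using \<open>m \<ge> 1\<close> by simp
qed

lemma smaller_plus_larger_before:
  assumes "inj_on \<sigma> {1..m}"
  shows "smaller_before \<sigma> m + card {j \<in> {1..<m}. \<sigma> j > \<sigma> m} = m - 1"
proof -
  have "\<sigma> j \<noteq> \<sigma> m" if "j \<in> {1..<m}" for j
    using inj_onD[OF assms, of j m] that by auto
  hence "\<sigma> j < \<sigma> m \<or> \<sigma> j > \<sigma> m" if "j \<in> {1..<m}" for j
    using that by (meson linorder_neqE)
  hence split: "{1..<m} = {j \<in> {1..<m}. \<sigma> j < \<sigma> m} \<union> {j \<in> {1..<m}. \<sigma> j > \<sigma> m}"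
    by blast
  have "card {1..<m} = card ({j \<in> {1..<m}. \<sigma> j < \<sigma> m} \<union> {j \<in> {1..<m}. \<sigma> j > \<sigma> m})"
    using split by (rule arg_cong)
  also have "\<dots> = smaller_before \<sigma> m + card {j \<in> {1..<m}. \<sigma> j > \<sigma> m}"
    unfolding smaller_before_def by (intro card_Un_disjoint) auto
  finally show ?thesis by simp
qed

text \<open>
  The ranges of the two branches are \<open>{m..<2 * m}\<close> and \<open>{..<m}\<close>. So a comparison of the
  entry with \<open>m\<close> reveals the sign, and then \<open>smaller_before\<close> can be solved for.
\<close>

lemma inv_code_eq:
  assumes "\<pi> \<in> hyperoctahedral n" "m \<in> {1..n}"
  shows "inv_code n \<pi> m =
    (if \<pi> (int m) < 0 then m + smaller_before (und_perm \<pi>) m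
     else m - 1 - smaller_before (und_perm \<pi>) m)"
proof -
  have m: "n + 1 - (n + 1 - m) = m" using assms by auto
  have "inj_on (und_perm \<pi>) {1..m}"
    using und_perm_bij[OF assms(1)] assms(2)
    by (auto simp: bij_betw_def intro: inj_on_subset)
  from smaller_plus_larger_before[OF this] assms(2) show ?thesis
    by (auto simp: inv_code_def inv_pi_def inv_sigma_def sgn_exp_def Let_def m
        smaller_before_def)
qed

lemma inv_code_in_codes:
  assumes "\<pi> \<in> hyperoctahedral n"
  shows "inv_code n \<pi> \<in> codes n"
proof -
  have "inv_code n \<pi> m < 2 * m" if "m \<in> {1..n}" for m
    using inv_code_eq[OF assms that] smaller_before_less[of m "und_perm \<pi>"] that by auto
  thus ?thesis by (auto simp: codes_def inv_code_def)
qed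

text \<open>
  Equal codes have equal signs and equal \<open>smaller_before\<close> counts, hence equal values at
  \<open>1, \<dots>, n\<close>; the oddness of signed permutations carries this over to \<open>-n, \<dots>, -1\<close>.
\<close>

lemma inj_on_inv_code: "inj_on (inv_code n) (hyperoctahedral n)"
proof (rule inj_onI)
  fix \<pi> \<rho>
  assume \<pi>: "\<pi> \<in> hyperoctahedral n" and \<rho>: "\<rho> \<in> hyperoctahedral n"
    and eq: "inv_code n \<pi> = inv_code n \<rho>"
  have sign: "\<pi> (int m) < 0 \<longleftrightarrow> \<rho> (int m) < 0"
    and count: "smaller_before (und_perm \<pi>) m = smaller_before (und_perm \<rho>) m"
    if "m \<in> {1..n}" for m
    using inv_code_eq[OF \<pi> that] inv_code_eq[OF \<rho> that] eq that
      smaller_before_less[of m "und_perm \<pi>"] smaller_before_less[of m "und_perm \<rho>"]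
    by (auto split: if_splits)
  have pos: "\<pi> (int m) = \<rho> (int m)" if "m \<in> {1..n}" for m
  proof -
    have "und_perm \<pi> m = und_perm \<rho> m"
      using count by (rule bij_betw_eq_if_smaller_before_eq[OF und_perm_bij[OF \<pi>] und_perm_bij[OF \<rho>] _ that])
    thus ?thesis
      using sign[OF that] by (auto simp: und_perm_def)
  qed
  have neg: "\<pi> (- int m) = \<rho> (- int m)" if "m \<in> {1..n}" for m
    using pos[OF that] \<pi> \<rho> that by (simp add: hyperoctahedral_def)
  have perm: "\<pi> permutes ({- int n..int n} - {0})" "\<rho> permutes ({- int n..int n} - {0})"
    using \<pi> \<rho> by (auto simp: hyperoctahedral_def)
  show "\<pi> = \<rho>"
  proof
    fix x
    consider "x \<notin> {- int n..int n} - {0}" | "x \<in> {1..int n}" | "- x \<in> {1..int n}"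
      by fastforce
    thus "\<pi> x = \<rho> x"
    proof cases
      case 1 thus ?thesis using permutes_not_in perm by metis
    next
      case 2
      hence "nat x \<in> {1..n}" by auto
      from pos[OF this] 2 show ?thesis by simp
    next
      case 3
      hence "nat (- x) \<in> {1..n}" by auto
      from neg[OF this] 3 show ?thesis by simp
    qed
  qed
qed

text \<open>
  The signed permutation with underlying permutation \<open>\<sigma>\<close> and with its negative signs at the
  positions in \<open>S\<close>. The factor \<open>sgn x\<close> makes it odd, and also makes it fix every
  \<open>x\<close> such that \<open>\<sigma>\<close> fixes \<open>\<bar>x\<bar>\<close> and \<open>\<bar>x\<bar> \<notin> S\<close>.
\<close>

definition signed_perm :: "(nat \<Rightarrow> nat) \<Rightarrow> nat set \<Rightarrow> int \<Rightarrow> int" where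
  "signed_perm \<sigma> S x = (if nat \<bar>x\<bar> \<in> S then - sgn x else sgn x) * int (\<sigma> (nat \<bar>x\<bar>))"

lemma signed_perm_minus: "signed_perm \<sigma> S (- x) = - signed_perm \<sigma> S x"
  by (simp add: signed_perm_def sgn_minus)

text \<open>
  Injectivity: \<open>\<bar>x\<bar>\<close> is recovered from the absolute value of the image, and
  \<open>x\<close> and \<open>- x\<close> have different images because these are nonzero and opposite.
\<close>

lemma signed_perm_in_hyperoctahedral:
  assumes \<sigma>: "\<sigma> permutes {1..n}" and S: "S \<subseteq> {1..n}"
  shows "signed_perm \<sigma> S \<in> hyperoctahedral n"
proof -
  let ?U = "{- int n..int n} - {0}" and ?\<pi> = "signed_perm \<sigma> S"
  have abs: "\<bar>?\<pi> x\<bar> = int (\<sigma> (nat \<bar>x\<bar>))" if "x \<noteq> 0" for x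
    using that by (auto simp: signed_perm_def abs_mult)
  have range: "\<sigma> (nat \<bar>x\<bar>) \<in> {1..n}" if "x \<in> ?U" for x
    using permutes_in_image[OF \<sigma>, of "nat \<bar>x\<bar>"] that by auto
  have into: "?\<pi> x \<in> ?U" if "x \<in> ?U" for x
    using abs[of x] range[OF that] that by auto
  have inj: "inj_on ?\<pi> ?U"
  proof (rule inj_onI)
    fix x y assume x: "x \<in> ?U" and y: "y \<in> ?U" and eq: "?\<pi> x = ?\<pi> y"
    hence "\<sigma> (nat \<bar>x\<bar>) = \<sigma> (nat \<bar>y\<bar>)"
      using abs[of x] abs[of y] by auto
    hence "x = y \<or> x = - y"
      using permutes_inj[OF \<sigma>] by (auto simp: inj_eq)
    moreover have "x \<noteq> - y"
      using eq into[OF y] by (auto simp: signed_perm_minus)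
    ultimately show "x = y" by blast
  qed
  have "bij_betw ?\<pi> ?U ?U"
    using endo_inj_surj[OF _ image_subsetI[OF into] inj] inj by (simp add: bij_betw_def)
  moreover have "?\<pi> x = x" if "x \<notin> ?U" for x
  proof -
    have out: "nat \<bar>x\<bar> \<notin> {1..n}" using that by auto
    moreover have "nat \<bar>x\<bar> \<notin> S" using out S by blast
    ultimately show ?thesis
      using permutes_not_in[OF \<sigma> out] by (simp add: signed_perm_def sgn_mult_abs)
  qed
  ultimately have "?\<pi> permutes ?U" by (intro bij_imp_permutes)
  thus ?thesis by (simp add: hyperoctahedral_def signed_perm_minus)
qed

lemma finite_hyperoctahedral: "finite (hyperoctahedral n)"
  by (rule finite_subset[OF _ finite_permutations[of "{- int n..int n} - {0}"]])
     (auto simp: hyperoctahedral_def)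

text \<open>
  Only the lower bound on the order of the group is proved, because together with the
  injectivity of the code it already forces surjectivity onto \<open>codes n\<close>.
\<close>

lemma card_hyperoctahedral_ge: "2 ^ n * fact n \<le> card (hyperoctahedral n)"
proof -
  let ?D = "{\<sigma>. \<sigma> permutes {1..n}} \<times> Pow {1..n}"
  have inj: "inj_on (\<lambda>(\<sigma>, S). signed_perm \<sigma> S) ?D"
  proof (rule inj_onI, clarify)
    fix \<sigma> S \<tau> T
    assume \<sigma>: "\<sigma> permutes {1..n}" and \<tau>: "\<tau> permutes {1..n}"
      and S: "S \<subseteq> {1..n}" and T: "T \<subseteq> {1..n}"
      and eq: "signed_perm \<sigma> S = signed_perm \<tau> T"
    have pt: "\<sigma> p = \<tau> p \<and> (p \<in> S \<longleftrightarrow> p \<in> T)" if "p \<in> {1..n}" for p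
    proof -
      have "\<sigma> p \<in> {1..n}" "\<tau> p \<in> {1..n}"
        using permutes_in_image[OF \<sigma>] permutes_in_image[OF \<tau>] that by blast+
      thus ?thesis using fun_cong[OF eq, of "int p"] that
        by (auto simp: signed_perm_def split: if_splits)
    qed
    have "\<sigma> p = \<tau> p" for p
      using pt permutes_not_in[OF \<sigma>] permutes_not_in[OF \<tau>] by (cases "p \<in> {1..n}") auto
    moreover have "S = T" using pt S T by blast
    ultimately show "\<sigma> = \<tau> \<and> S = T" by blast
  qed
  have "card ?D = 2 ^ n * fact n"
    by (simp add: card_cartesian_product card_permutations card_Pow)
  moreover have "card ?D \<le> card (hyperoctahedral n)"
    using inj by (rule card_inj_on_le)
      (auto simp: signed_perm_in_hyperoctahedral finite_hyperoctahedral)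
  ultimately show ?thesis by simp
qed

lemma bij_betw_inv_code: "bij_betw (inv_code n) (hyperoctahedral n) (codes n)"
proof -
  have sub: "inv_code n ` hyperoctahedral n \<subseteq> codes n"
    by (auto simp: inv_code_in_codes)
  have "card (codes n) \<le> card (inv_code n ` hyperoctahedral n)"
    using card_hyperoctahedral_ge[of n] by (simp add: card_codes card_image inj_on_inv_code)
  hence "inv_code n ` hyperoctahedral n = codes n"
    by (intro card_seteq finite_codes sub)
  thus ?thesis by (simp add: bij_betw_def inj_on_inv_code)
qed

text \<open>
  The substitution \<open>m = n + 1 - i\<close>, for an arbitrary summand \<open>f\<close> so that it serves both
  for \<open>inv\<^sub>B\<close> and for \<open>\<omega>\<close>.
\<close>

lemma sum_inv_pi_eq_sum_inv_code:
  "(\<Sum>i=1..n. f (n - i + 1) (inv_pi n \<pi> i)) = (\<Sum>m=1..n. f m (inv_code n \<pi> m))"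
proof -
  have "(\<Sum>m=1..n. f m (inv_code n \<pi> m)) =
      (\<Sum>i=1..n. f (n + 1 - i) (inv_code n \<pi> (n + 1 - i)))"
    by (rule sum.atLeastAtMost_rev[of "\<lambda>m. f m (inv_code n \<pi> m)"])
  also have "\<dots> = (\<Sum>i=1..n. f (n - i + 1) (inv_pi n \<pi> i))"
  proof (rule sum.cong)
    fix i assume "i \<in> {1..n}"
    hence i: "n + 1 - i \<in> {1..n}" "n + 1 - (n + 1 - i) = i" "n + 1 - i = n - i + 1"
      by auto
    have "inv_code n \<pi> (n + 1 - i) = inv_pi n \<pi> i"
      using i(1,2) by (simp only: inv_code_def restrict_apply' split: if_split)
    thus "f (n + 1 - i) (inv_code n \<pi> (n + 1 - i)) = f (n - i + 1) (inv_pi n \<pi> i)"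
      by (simp only: i(3))
  qed (rule refl)
  finally show ?thesis by (rule sym)
qed

section \<open>Lattice paths and their North steps\<close>

lemma norths_at_Nil: "norths_at [] j = 0"
  by (simp add: norths_at_def)

text \<open>
  A first step to the North adds one to the count on the line \<open>x = 0\<close>; a first step to the
  East shifts all the lines of the remaining path by one and leaves \<open>x = 0\<close> empty. With this
  recursion the facts about paths below need no further reasoning on coordinates.
\<close>

lemma norths_at_Cons:
  "norths_at (s # w) j =
     (case s of North \<Rightarrow> norths_at w j + (if j = 0 then 1 else 0)
      | East \<Rightarrow> (case j of 0 \<Rightarrow> 0 | Suc i \<Rightarrow> norths_at w i))"
proof -
  \<comment> \<open>the displacement in the \<open>x\<close> direction caused by the first step\<close>
  define e where "e = (if s = East then 1 else 0 :: nat)"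
  let ?A = "{t. t < length w \<and> w ! t = North \<and> e + x_coord w t = j}"
  have x: "x_coord (s # w) (Suc t) = e + x_coord w t" for t
    by (simp add: x_coord_def e_def)
  have "{t. t < length (s # w) \<and> (s # w) ! t = North \<and> x_coord (s # w) t = j} =
      {t. t = 0 \<and> s = North \<and> j = 0} \<union> Suc ` ?A" (is "?L = ?R")
  proof (rule set_eqI)
    fix t show "t \<in> ?L \<longleftrightarrow> t \<in> ?R"
      by (cases t) (auto simp: x, auto simp: x_coord_def)
  qed
  hence "norths_at (s # w) j = card ({t. t = 0 \<and> s = North \<and> j = 0} \<union> Suc ` ?A)"
    by (simp add: norths_at_def)
  also have "\<dots> = card {t::nat. t = 0 \<and> s = North \<and> j = 0} + card ?A"
    by (subst card_Un_disjoint) (auto simp: card_image)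
  also have "\<dots> = (case s of North \<Rightarrow> norths_at w j + (if j = 0 then 1 else 0)
      | East \<Rightarrow> (case j of 0 \<Rightarrow> 0 | Suc i \<Rightarrow> norths_at w i))"
    by (auto simp: e_def norths_at_def split: step.split nat.split)
  finally show ?thesis .
qed

text \<open>
  The first step of a path can be read off: it is North iff \<open>norths_at\<close> is positive on
  \<open>x = 0\<close>. The number of East steps has to be given as well, because East steps at the end
  of a path are invisible to \<open>norths_at\<close>.
\<close>

lemma path_eq_if_norths_at_eq:
  assumes "count_list w East = count_list v East"
    and "\<And>j. j \<le> count_list w East \<Longrightarrow> norths_at w j = norths_at v j"
  shows "w = v"
  using assms
proof (induction w arbitrary: v)
  case Nil
  from Nil(1) Nil(2)[of 0] show ?case
    by (cases v) (auto simp: norths_at_Nil norths_at_Cons split: step.splits if_splits)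
next
  case (Cons s w)
  note eq = Cons.prems(2)
  show ?case
  proof (cases s)
    case North
    then obtain v' where v: "v = North # v'"
      using eq[of 0]
      by (cases v) (auto simp: norths_at_Nil norths_at_Cons split: step.splits)
    have "w = v'"
    proof (rule Cons.IH)
      show "count_list w East = count_list v' East" using Cons.prems(1) North v by simp
      show "norths_at w j = norths_at v' j" if "j \<le> count_list w East" for j
        using eq[of j] that North v by (simp add: norths_at_Cons)
    qed
    thus ?thesis by (simp add: North v)
  next
    case East
    then obtain v' where v: "v = East # v'"
      using eq[of 0] Cons.prems(1)
      by (cases v) (auto simp: norths_at_Nil norths_at_Cons split: step.splits)
    have "w = v'"
    proof (rule Cons.IH)
      show "count_list w East = count_list v' East" using Cons.prems(1) East v by simp
      show "norths_at w j = norths_at v' j" if "j \<le> count_list w East" for j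
        using eq[of "Suc j"] that East v by (simp add: norths_at_Cons)
    qed
    thus ?thesis by (simp add: East v)
  qed
qed

lemma norths_at_replicate_North_append:
  "norths_at (replicate a North @ w) j = norths_at w j + (if j = 0 then a else 0)"
  by (induction a) (auto simp: norths_at_Cons)

text \<open>The witness is the path \<open>North ^ f 0, East, North ^ f 1, East, \<dots>, East, North ^ f n\<close>.\<close>

lemma ex_path_norths_at:
  "\<exists>w. count_list w East = n \<and> (\<forall>j\<le>n. norths_at w j = f j)"
proof (induction n arbitrary: f)
  case 0
  have "count_list (replicate a North) East = 0" for a
    by (induction a) auto
  thus ?case
    using norths_at_replicate_North_append[of "f 0" "[]" 0]
    by (intro exI[of _ "replicate (f 0) North"]) (simp add: norths_at_Nil)
next
  case (Suc n)
  obtain w where w: "count_list w East = n" "\<forall>j\<le>n. norths_at w j = f (Suc j)"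
    using Suc[of "\<lambda>j. f (Suc j)"] by blast
  have "count_list (replicate a North @ East # w) East = Suc n" for a
    by (induction a) (auto simp: w)
  moreover have "norths_at (replicate (f 0) North @ East # w) j = f j" if "j \<le> Suc n" for j
    using w(2) that by (cases j) (auto simp: norths_at_replicate_North_append norths_at_Cons)
  ultimately show ?case by blast
qed

lemma count_North_eq_sum_norths_at:
  "count_list w North = (\<Sum>j\<le>count_list w East. norths_at w j)"
proof (induction w)
  case (Cons s w)
  thus ?case
  proof (cases s)
    case North
    thus ?thesis using Cons by (simp add: norths_at_Cons sum.distrib)
  next
    case East
    thus ?thesis using Cons
      by (simp add: norths_at_Cons sum.atMost_Suc_shift del: sum.atMost_Suc)
  qed
qed (simp add: norths_at_Nil)

definition north_code :: "nat \<Rightarrow> step list \<Rightarrow> nat \<Rightarrow> nat" where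
  "north_code n w = (\<lambda>j\<in>{1..n}. norths_at w j)"

text \<open>
  A path with no North steps on \<open>x = 0\<close> is the same as a free choice of the numbers of North
  steps on the other lines, and its height is their sum.
\<close>

lemma bij_betw_north_code:
  "bij_betw (north_code n) (paths_B n k) {c \<in> codes n. (\<Sum>m=1..n. c m) = k}"
proof (rule bij_betw_imageI)
  \<comment> \<open>membership in terms of the North step counts alone; \<open>j \<ge> 1\<close> keeps the
    subtraction in the bound \<open>2 * j - 1\<close> from being truncated\<close>
  have paths: "w \<in> paths_B n k \<longleftrightarrow> count_list w East = n \<and> norths_at w 0 = 0 \<and>
      (\<forall>j\<in>{1..n}. norths_at w j < 2 * j) \<and> (\<Sum>j=1..n. norths_at w j) = k" for w
  proof -
    have "norths_at w j \<le> 2 * j - 1 \<longleftrightarrow> norths_at w j < 2 * j" if "j \<in> {1..n}" for j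
      using that by auto
    moreover have "(\<Sum>j\<le>n. norths_at w j) = norths_at w 0 + (\<Sum>j=1..n. norths_at w j)"
      by (simp add: sum.atLeast_Suc_atMost atMost_atLeast0)
    ultimately show ?thesis
      using count_North_eq_sum_norths_at[of w]
      by (auto simp: paths_B_def lattice_paths_def x_coord_def y_coord_def)
  qed
  show "inj_on (north_code n) (paths_B n k)"
  proof (rule inj_onI)
    fix w v assume w: "w \<in> paths_B n k" and v: "v \<in> paths_B n k"
      and eq: "north_code n w = north_code n v"
    have "norths_at w j = norths_at v j" if "j \<le> n" for j
      using fun_cong[OF eq, of j] w v that
      by (cases "j = 0") (auto simp: paths north_code_def)
    thus "w = v"
      using w v by (intro path_eq_if_norths_at_eq) (auto simp: paths)
  qed
  show "north_code n ` paths_B n k = {c \<in> codes n. (\<Sum>m=1..n. c m) = k}"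
  proof (intro subset_antisym subsetI)
    fix c assume "c \<in> north_code n ` paths_B n k"
    thus "c \<in> {c \<in> codes n. (\<Sum>m=1..n. c m) = k}"
      by (auto simp: codes_def north_code_def paths)
  next
    fix c assume "c \<in> {c \<in> codes n. (\<Sum>m=1..n. c m) = k}"
    hence c: "c \<in> codes n" "(\<Sum>m=1..n. c m) = k" by auto
    obtain w where w: "count_list w East = n"
      "\<And>j. j \<le> n \<Longrightarrow> norths_at w j = (if j = 0 then 0 else c j)"
      using ex_path_norths_at[of n "\<lambda>j. if j = 0 then 0 else c j"] by blast
    have "w \<in> paths_B n k"
      using w c by (auto simp: paths codes_def PiE_iff)
    moreover have "north_code n w = c"
      using w(2) c(1) by (auto simp: north_code_def codes_def PiE_iff extensional_def fun_eq_iff)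
    ultimately show "c \<in> north_code n ` paths_B n k" by blast
  qed
qed

section \<open>Comparing the two generating functions\<close>

text \<open>
  Both sums are transported along the bijections with codes, which turn \<open>\<omega>\<close> and the box count
  into the same weight.
\<close>

lemma q_mahonian_B_eq_sum_codes:
  "q_mahonian_B n k =
     (\<Sum>c | c \<in> codes n \<and> (\<Sum>m=1..n. c m) = k. q_var ^ (\<Sum>m=1..n. m * c m))"
proof -
  have total: "inv_B n \<pi> = (\<Sum>m=1..n. inv_code n \<pi> m)" for \<pi>
    unfolding inv_B_def by (rule sum_inv_pi_eq_sum_inv_code)
  have weight: "omega n \<pi> = (\<Sum>m=1..n. m * inv_code n \<pi> m)" for \<pi>
    unfolding omega_def by (rule sum_inv_pi_eq_sum_inv_code)
  have "bij_betw (inv_code n) (I_B n k) {c \<in> codes n. (\<Sum>m=1..n. c m) = k}"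
    using bij_betw_inv_code[of n] by (auto simp: bij_betw_def I_B_def total inj_on_def)
  thus ?thesis
    unfolding q_mahonian_B_def weight by (rule sum.reindex_bij_betw)
qed

lemma sum_paths_B_eq_sum_codes:
  "(\<Sum>P\<in>paths_B n k. q_var ^ path_weight n k P) =
     (\<Sum>c | c \<in> codes n \<and> (\<Sum>m=1..n. c m) = k. q_var ^ (\<Sum>m=1..n. m * c m))"
proof -
  have "path_weight n k P = (\<Sum>m=1..n. m * north_code n P m)" if "P \<in> paths_B n k" for P
    using that path_weight_eq_sum[of P n k] by (simp add: paths_B_def north_code_def)
  hence "(\<Sum>P\<in>paths_B n k. q_var ^ path_weight n k P) =
      (\<Sum>P\<in>paths_B n k. q_var ^ (\<Sum>m=1..n. m * north_code n P m))"
    by simp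
  also have "\<dots> = (\<Sum>c | c \<in> codes n \<and> (\<Sum>m=1..n. c m) = k. q_var ^ (\<Sum>m=1..n. m * c m))"
    using bij_betw_north_code by (rule sum.reindex_bij_betw)
  finally show ?thesis .
qed

theorem theorem4p6:
  fixes n k :: nat
  assumes "n \<ge> 1" and "k \<le> n ^ 2"
  shows "q_mahonian_B n k = (\<Sum>P\<in>paths_B n k. q_var ^ path_weight n k P)"
  unfolding q_mahonian_B_eq_sum_codes sum_paths_B_eq_sum_codes ..

end
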